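(* Let $F\colon \mathcal{C}\to\mathcal{W}$ be a forward kinematic map. If $F$ admits a robust roadmap, i.e. a continuous map $\rho\colon \mathcal{C}\times\mathcal{W}\to \mathrm{P}(\mathcal{C})$ with $\rho(c,w)(0)=c$ and $F(\rho(c,w)(1))=w$ for all $(c,w)\in\mathcal{C}\times\mathcal{W}$, then $F$ also admits a continuous inverse kinematic map, i.e. a continuous map $I\colon\mathcal{W}\to\mathcal{C}$ such that $F(I(w))=w$ for all $w\in\mathcal{W}$.
   Context: A forward kinematic map is a continuous map $F\colon\mathcal{C}\to\mathcal{W}$ between (nonempty) topological spaces, called the configuration space $\mathcal{C}$ and the working space $\mathcal{W}$. $\mathrm{P}(\mathcal{C})$ is the space of all continuous paths $[0,1]\to\mathcal{C}$ (with the compact-open topology). *)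

theory Defs
  imports "HOL-Analysis.Analysis"
begin

text \<open>
  Points of the function space are the continuous maps made extensional outside the carrier of
  the domain, so that each continuous map is represented by exactly one function.
\<close>

definition continuous_maps :: "'a topology \<Rightarrow> 'b topology \<Rightarrow> ('a \<Rightarrow> 'b) set" where
  "continuous_maps X Y = {f \<in> extensional (topspace X). continuous_map X Y f}"

definition compact_open_topology :: "'a topology \<Rightarrow> 'b topology \<Rightarrow> ('a \<Rightarrow> 'b) topology" where
  "compact_open_topology X Y =
     topology_generated_by
       {{f \<in> continuous_maps X Y. f ` K \<subseteq> U} | K U. compactin X K \<and> openin Y U}"

lemma topspace_compact_open_topology [simp]:
  "topspace (compact_open_topology X Y) = continuous_maps X Y"
proof -
  have "{f \<in> continuous_maps X Y. f ` {} \<subseteq> {}} \<in>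
      {{f \<in> continuous_maps X Y. f ` K \<subseteq> U} | K U. compactin X K \<and> openin Y U}"
    by (intro CollectI exI[of _ "{}"]) auto
  then show ?thesis
    unfolding compact_open_topology_def topology_generated_by_topspace by blast
qed

definition path_space :: "'a topology \<Rightarrow> (real \<Rightarrow> 'a) topology" where
  "path_space C = compact_open_topology (top_of_set {0..1}) C"

lemma topspace_path_space:
  "topspace (path_space C) = {p \<in> extensional {0..1}. pathin C p}"
  by (simp add: path_space_def continuous_maps_def pathin_def)

definition forward_kinematic_map :: "'c topology \<Rightarrow> 'w topology \<Rightarrow> ('c \<Rightarrow> 'w) \<Rightarrow> bool" where
  "forward_kinematic_map C W F \<longleftrightarrow>
     topspace C \<noteq> {} \<and> topspace W \<noteq> {} \<and> continuous_map C W F"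

definition robust_roadmap ::
  "'c topology \<Rightarrow> 'w topology \<Rightarrow> ('c \<Rightarrow> 'w) \<Rightarrow> ('c \<times> 'w \<Rightarrow> real \<Rightarrow> 'c) \<Rightarrow> bool" where
  "robust_roadmap C W F \<rho> \<longleftrightarrow>
     continuous_map (prod_topology C W) (path_space C) \<rho> \<and>
     (\<forall>c \<in> topspace C. \<forall>w \<in> topspace W. \<rho> (c, w) 0 = c \<and> F (\<rho> (c, w) 1) = w)"

definition continuous_inverse_kinematic_map ::
  "'c topology \<Rightarrow> 'w topology \<Rightarrow> ('c \<Rightarrow> 'w) \<Rightarrow> ('w \<Rightarrow> 'c) \<Rightarrow> bool" where
  "continuous_inverse_kinematic_map C W F I \<longleftrightarrow>
     continuous_map W C I \<and> (\<forall>w \<in> topspace W. F (I w) = w)"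

end

theory Submission
  imports Defs
begin

text \<open>
  A roadmap started at one fixed configuration \<open>c\<^sub>0\<close> already solves the inverse problem: the path
  \<open>\<rho> (c\<^sub>0, w)\<close> ends at a configuration that \<open>F\<close> sends to \<open>w\<close>, so \<open>I w = \<rho> (c\<^sub>0, w) 1\<close> is a section
  of \<open>F\<close>. It is continuous as the composite \<open>W \<rightarrow> C \<times> W \<rightarrow> P(C) \<rightarrow> C\<close> of the inclusion of the slice
  at \<open>c\<^sub>0\<close>, the roadmap, and evaluation at the endpoint of a path. Only the last of these needs
  an argument about the compact-open topology, given in \<open>continuous_map_evaluation\<close>.
\<close>

text \<open>
  Points are compact, so the maps sending \<open>x\<close> into a given open set form one of the subbasic
  open sets.
\<close>
lemma continuous_map_evaluation:
  assumes "x \<in> topspace X"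
  shows "continuous_map (compact_open_topology X Y) Y (\<lambda>f. f x)"
  unfolding continuous_map_def
proof (intro conjI allI impI)
  show "(\<lambda>f. f x) \<in> topspace (compact_open_topology X Y) \<rightarrow> topspace Y"
    using assms by (auto simp: continuous_maps_def continuous_map_def)
next
  fix U assume "openin Y U"
  moreover have "compactin X {x}"
    using assms by simp
  ultimately have "openin (compact_open_topology X Y) {f \<in> continuous_maps X Y. f ` {x} \<subseteq> U}"
    unfolding compact_open_topology_def
    by (intro topology_generated_by_Basis) blast
  then show "openin (compact_open_topology X Y)
      {f \<in> topspace (compact_open_topology X Y). f x \<in> U}"
    by simp
qed

theorem theorem2p1:
  fixes C :: "'c topology" and W :: "'w topology" and F :: "'c \<Rightarrow> 'w"
  assumes "forward_kinematic_map C W F"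
    and "\<exists>\<rho>. robust_roadmap C W F \<rho>"
  shows "\<exists>I. continuous_inverse_kinematic_map C W F I"
proof -
  obtain \<rho> where roadmap: "continuous_map (prod_topology C W) (path_space C) \<rho>"
    and endpoint: "\<And>c w. c \<in> topspace C \<Longrightarrow> w \<in> topspace W \<Longrightarrow> F (\<rho> (c, w) 1) = w"
    using assms(2) by (auto simp: robust_roadmap_def)
  obtain c\<^sub>0 where c\<^sub>0: "c\<^sub>0 \<in> topspace C"
    using assms(1) unfolding forward_kinematic_map_def by blast
  have slice: "continuous_map W (prod_topology C W) (\<lambda>w. (c\<^sub>0, w))"
    using c\<^sub>0 by (simp add: continuous_map_pairwise o_def)
  have "continuous_map (path_space C) C (\<lambda>p. p 1)"
    unfolding path_space_def by (rule continuous_map_evaluation) simp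
  from continuous_map_compose[OF continuous_map_compose[OF slice roadmap] this]
  have "continuous_map W C (\<lambda>w. \<rho> (c\<^sub>0, w) 1)"
    by (simp add: o_def)
  with c\<^sub>0 endpoint have "continuous_inverse_kinematic_map C W F (\<lambda>w. \<rho> (c\<^sub>0, w) 1)"
    by (simp add: continuous_inverse_kinematic_map_def)
  then show ?thesis by blast
qed

end
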